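(* Let $\mathcal{A},\mathcal{B}\in\mathbb{C}^{\mathbf{N}(n)\times\mathbf{N}(n)}$ be such that $\mathcal{A}$, $\mathcal{B}$ and $\mathcal{A}*_n\mathcal{B}$ are core tensors. If $\mathcal{A}*_n\mathcal{B}*_n\mathcal{B}^{\mathrm{core}}=\mathcal{B}*_n\mathcal{B}^{\mathrm{core}}*_n\mathcal{A}$ and $\mathcal{B}*_n\mathcal{A}*_n\mathcal{A}^{\mathrm{core}}=\mathcal{A}*_n\mathcal{A}^{\mathrm{core}}*_n\mathcal{B}$, then $(\mathcal{A}*_n\mathcal{B})^{\mathrm{core}}=\mathcal{B}^{\mathrm{core}}*_n\mathcal{A}^{\mathrm{core}}$.
   Context: Here $\mathbf{N}(n)=N_1\times\cdots\times N_n$ and $\mathbb{C}^{\mathbf{N}(n)\times\mathbf{N}(n)}$ is the set of complex tensors $\mathcal{A}=(a_{i_1\ldots i_n j_1\ldots j_n})$ with $1\le i_k,j_k\le N_k$. The Einstein product is $(\mathcal{A}*_n\mathcal{B})_{i_1\ldots i_n j_1\ldots j_n}=\sum_{k_1,\ldots,k_n}a_{i_1\ldots i_n k_1\ldots k_n}b_{k_1\ldots k_n j_1\ldots j_n}$ (and similarly $\mathcal{A}*_n\mathcal{X}\in\mathbb{C}^{\mathbf{N}(n)}$ for $\mathcal{X}\in\mathbb{C}^{\mathbf{N}(n)}$), powers are taken with respect to $*_n$, and $\mathcal{A}^*$ is the conjugate transpose (swap the first $n$ and last $n$ indices and conjugate). The range is $\mathscr{R}(\mathcal{A})=\{\mathcal{A}*_n\mathcal{X}:\mathcal{X}\in\mathbb{C}^{\mathbf{N}(n)}\}$.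 The index $\mathrm{ind}(\mathcal{A})$ is the smallest positive integer $k$ with $\mathscr{R}(\mathcal{A}^k)=\mathscr{R}(\mathcal{A}^{k+1})$; $\mathcal{A}$ is a core tensor if $\mathrm{ind}(\mathcal{A})=1$. The core inverse $\mathcal{A}^{\mathrm{core}}$ is the (unique, existing when $\mathcal{A}$ is a core tensor) tensor $\mathcal{X}$ with $(\mathcal{A}*_n\mathcal{X})^*=\mathcal{A}*_n\mathcal{X}$, $\mathcal{X}*_n\mathcal{A}^2=\mathcal{A}$, $\mathcal{A}*_n\mathcal{X}^2=\mathcal{X}$. *)

theory Defs
  imports "HOL-Analysis.Analysis"
begin

text \<open>
  The dimensions \<open>N\<^sub>1, \<dots>, N\<^sub>n\<close> form a list \<open>N\<close> of length \<open>n\<close>, and a multi-index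
  \<open>i\<^sub>1 \<dots> i\<^sub>n\<close> is a list of the same length with \<open>1 \<le> i\<^sub>k \<le> N\<^sub>k\<close>.
\<close>

definition multi_indices :: "nat list \<Rightarrow> nat list set" where
  "multi_indices N = {is. list_all2 (\<lambda>i m. 1 \<le> i \<and> i \<le> m) is N}"

text \<open>
  Tensors are functions on lists that vanish outside the multi-indices of \<open>N\<close>. Thus two tensors
  are equal as functions iff all their entries agree.
\<close>

definition vec_tensors :: "nat list \<Rightarrow> (nat list \<Rightarrow> complex) set" where
  "vec_tensors N = {X. \<forall>i. i \<notin> multi_indices N \<longrightarrow> X i = 0}"

definition sq_tensors :: "nat list \<Rightarrow> (nat list \<Rightarrow> nat list \<Rightarrow> complex) set" where
  "sq_tensors N = {A. \<forall>i j. i \<notin> multi_indices N \<or> j \<notin> multi_indices N \<longrightarrow> A i j = 0}"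

definition einstein_prod ::
  "nat list \<Rightarrow> (nat list \<Rightarrow> nat list \<Rightarrow> complex) \<Rightarrow> (nat list \<Rightarrow> nat list \<Rightarrow> complex)
    \<Rightarrow> (nat list \<Rightarrow> nat list \<Rightarrow> complex)" where
  "einstein_prod N A B = (\<lambda>i j. \<Sum>k\<in>multi_indices N. A i k * B k j)"

abbreviation einstein_prod_syntax
    ("(_ \<star>\<^bsub>_\<^esub> _)" [70, 0, 71] 70) where
  "A \<star>\<^bsub>N\<^esub> B \<equiv> einstein_prod N A B"

definition einstein_apply ::
  "nat list \<Rightarrow> (nat list \<Rightarrow> nat list \<Rightarrow> complex) \<Rightarrow> (nat list \<Rightarrow> complex)
    \<Rightarrow> (nat list \<Rightarrow> complex)" where
  "einstein_apply N A X = (\<lambda>i. \<Sum>k\<in>multi_indices N. A i k * X k)"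

definition unit_tensor :: "nat list \<Rightarrow> nat list \<Rightarrow> nat list \<Rightarrow> complex" where
  "unit_tensor N = (\<lambda>i j. if i \<in> multi_indices N \<and> i = j then 1 else 0)"

primrec tensor_power ::
  "nat list \<Rightarrow> (nat list \<Rightarrow> nat list \<Rightarrow> complex) \<Rightarrow> nat \<Rightarrow> (nat list \<Rightarrow> nat list \<Rightarrow> complex)" where
  "tensor_power N A 0 = unit_tensor N"
| "tensor_power N A (Suc k) = tensor_power N A k \<star>\<^bsub>N\<^esub> A"

definition conj_transpose ::
  "(nat list \<Rightarrow> nat list \<Rightarrow> complex) \<Rightarrow> (nat list \<Rightarrow> nat list \<Rightarrow> complex)" where
  "conj_transpose A = (\<lambda>i j. cnj (A j i))"

definition tensor_range ::
  "nat list \<Rightarrow> (nat list \<Rightarrow> nat list \<Rightarrow> complex) \<Rightarrow> (nat list \<Rightarrow> complex) set" where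
  "tensor_range N A = einstein_apply N A ` vec_tensors N"

definition tensor_index :: "nat list \<Rightarrow> (nat list \<Rightarrow> nat list \<Rightarrow> complex) \<Rightarrow> nat" where
  "tensor_index N A = (LEAST k. 1 \<le> k \<and>
     tensor_range N (tensor_power N A k) = tensor_range N (tensor_power N A (k + 1)))"

definition core_tensor :: "nat list \<Rightarrow> (nat list \<Rightarrow> nat list \<Rightarrow> complex) \<Rightarrow> bool" where
  "core_tensor N A \<longleftrightarrow> A \<in> sq_tensors N \<and> tensor_index N A = 1"

definition is_core_inverse ::
  "nat list \<Rightarrow> (nat list \<Rightarrow> nat list \<Rightarrow> complex) \<Rightarrow> (nat list \<Rightarrow> nat list \<Rightarrow> complex) \<Rightarrow> bool" where
  "is_core_inverse N A X \<longleftrightarrow> X \<in> sq_tensors N \<and>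
     conj_transpose (A \<star>\<^bsub>N\<^esub> X) = A \<star>\<^bsub>N\<^esub> X \<and>
     X \<star>\<^bsub>N\<^esub> tensor_power N A 2 = A \<and>
     A \<star>\<^bsub>N\<^esub> tensor_power N X 2 = X"

text \<open>Meaningful only for core tensors, for which the core inverse exists and is unique.\<close>

definition core_inverse ::
  "nat list \<Rightarrow> (nat list \<Rightarrow> nat list \<Rightarrow> complex) \<Rightarrow> (nat list \<Rightarrow> nat list \<Rightarrow> complex)" where
  "core_inverse N A = (THE X. is_core_inverse N A X)"

end

theory Submission
  imports Defs
begin

text \<open>
  Let \<open>C = A \<star> B\<close> and \<open>Y = B\<^bsup>core\<^esup> \<star> A\<^bsup>core\<^esup>\<close>, and let \<open>P = A \<star> A\<^bsup>core\<^esup>\<close> and \<open>Q = B \<star> B\<^bsup>core\<^esup>\<close> be the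
  orthogonal projectors onto the ranges of \<open>A\<close> and \<open>B\<close>. The hypotheses say that \<open>Q\<close> commutes with
  \<open>A\<close> and \<open>P\<close> with \<open>B\<close>. Since \<open>P\<close> is Hermitian and commutes with \<open>B\<close>, it also commutes with
  \<open>Q\<close> and with \<open>B\<^bsup>core\<^esup>\<close> (\<open>commute_range_projector\<close>, \<open>commute_core_inverse\<close>). Hence
  \<open>C \<star> Y = Q \<star> P = P \<star> Q\<close> is Hermitian, \<open>C \<star> Y \<star> C = C\<close> and \<open>C \<star> Y\<^sup>2 = Y\<close>. These three equations
  force \<open>Y = C\<^bsup>core\<^esup>\<close> as soon as \<open>C\<close> has a core inverse (\<open>core_inverse_characterization\<close>).

  Existence of the core inverse of a core tensor rests on finite dimension. A linear relation
  between the powers of a tensor \<open>A\<close> gives \<open>A\<^sup>k = D \<star> A\<^bsup>k+1\<^esup>\<close> for a polynomial \<open>D\<close> in \<open>A\<close>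
  (\<open>power_strongly_regular\<close>). If \<open>A\<close> has index 1, this reduces to \<open>A = D \<star> A\<^sup>2\<close>. Applied to
  \<open>A\<^sup>* \<star> A\<close> for any \<open>A\<close>, it yields \<open>S\<close> with \<open>A \<star> S \<star> A = A\<close> and \<open>A \<star> S\<close> Hermitian
  (\<open>exists_13_inverse\<close>). The core inverse is then \<open>D \<star> A \<star> S\<close>.
\<close>

section \<open>Multiplication of tensors\<close>

lemma finite_multi_indices: "finite (multi_indices N)"
proof (induction N)
  case (Cons m N)
  have "multi_indices (m # N) \<subseteq> (\<lambda>(i, is). i # is) ` ({1..m} \<times> multi_indices N)"
    by (auto simp: multi_indices_def list_all2_Cons2 image_iff)
  then show ?case
    using Cons by (meson finite_SigmaI finite_atLeastAtMost finite_imageI finite_subset)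
qed (simp add: multi_indices_def)

lemma einstein_prod_assoc: "A \<star>\<^bsub>N\<^esub> B \<star>\<^bsub>N\<^esub> C = A \<star>\<^bsub>N\<^esub> (B \<star>\<^bsub>N\<^esub> C)"
proof (intro ext)
  fix i j
  have "(A \<star>\<^bsub>N\<^esub> B \<star>\<^bsub>N\<^esub> C) i j
      = (\<Sum>k\<in>multi_indices N. \<Sum>l\<in>multi_indices N. A i l * B l k * C k j)"
    by (simp add: einstein_prod_def sum_distrib_right)
  also have "\<dots> = (\<Sum>l\<in>multi_indices N. \<Sum>k\<in>multi_indices N. A i l * B l k * C k j)"
    by (rule sum.swap)
  also have "\<dots> = (A \<star>\<^bsub>N\<^esub> (B \<star>\<^bsub>N\<^esub> C)) i j"
    by (simp add: einstein_prod_def sum_distrib_left mult.assoc)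
  finally show "(A \<star>\<^bsub>N\<^esub> B \<star>\<^bsub>N\<^esub> C) i j = (A \<star>\<^bsub>N\<^esub> (B \<star>\<^bsub>N\<^esub> C)) i j" .
qed

lemma einstein_apply_prod:
  "einstein_apply N (A \<star>\<^bsub>N\<^esub> B) X = einstein_apply N A (einstein_apply N B X)"
proof
  fix i
  have "einstein_apply N (A \<star>\<^bsub>N\<^esub> B) X i
      = (\<Sum>k\<in>multi_indices N. \<Sum>l\<in>multi_indices N. A i l * B l k * X k)"
    by (simp add: einstein_prod_def einstein_apply_def sum_distrib_right)
  also have "\<dots> = (\<Sum>l\<in>multi_indices N. \<Sum>k\<in>multi_indices N. A i l * B l k * X k)"
    by (rule sum.swap)
  also have "\<dots> = einstein_apply N A (einstein_apply N B X) i"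
    by (simp add: einstein_apply_def sum_distrib_left mult.assoc)
  finally show "einstein_apply N (A \<star>\<^bsub>N\<^esub> B) X i = einstein_apply N A (einstein_apply N B X) i" .
qed

lemma einstein_prod_sq: "A \<in> sq_tensors N \<Longrightarrow> B \<in> sq_tensors N \<Longrightarrow> A \<star>\<^bsub>N\<^esub> B \<in> sq_tensors N"
  by (auto simp: sq_tensors_def einstein_prod_def)

lemma einstein_apply_vec: "A \<in> sq_tensors N \<Longrightarrow> einstein_apply N A X \<in> vec_tensors N"
  by (auto simp: sq_tensors_def vec_tensors_def einstein_apply_def)

lemma unit_tensor_sq: "unit_tensor N \<in> sq_tensors N"
  by (auto simp: sq_tensors_def unit_tensor_def)

lemma unit_tensor_left: "A \<in> sq_tensors N \<Longrightarrow> unit_tensor N \<star>\<^bsub>N\<^esub> A = A"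
proof (intro ext)
  fix i j assume A: "A \<in> sq_tensors N"
  have "(unit_tensor N \<star>\<^bsub>N\<^esub> A) i j = (\<Sum>k\<in>multi_indices N. if i = k then A k j else 0)"
    unfolding einstein_prod_def unit_tensor_def by (rule sum.cong) auto
  also have "\<dots> = A i j"
    using A by (simp add: finite_multi_indices sq_tensors_def)
  finally show "(unit_tensor N \<star>\<^bsub>N\<^esub> A) i j = A i j" .
qed

lemma unit_tensor_right: "A \<in> sq_tensors N \<Longrightarrow> A \<star>\<^bsub>N\<^esub> unit_tensor N = A"
proof (intro ext)
  fix i j assume A: "A \<in> sq_tensors N"
  have "(A \<star>\<^bsub>N\<^esub> unit_tensor N) i j = (\<Sum>k\<in>multi_indices N. if k = j then A i k else 0)"
    unfolding einstein_prod_def unit_tensor_def by (rule sum.cong) auto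
  also have "\<dots> = A i j"
    using A by (simp add: finite_multi_indices sq_tensors_def)
  finally show "(A \<star>\<^bsub>N\<^esub> unit_tensor N) i j = A i j" .
qed

lemma tensor_power_sq: "A \<in> sq_tensors N \<Longrightarrow> tensor_power N A k \<in> sq_tensors N"
  by (induction k) (auto intro: unit_tensor_sq einstein_prod_sq)

lemma tensor_power_commute:
  "A \<in> sq_tensors N \<Longrightarrow> tensor_power N A k \<star>\<^bsub>N\<^esub> A = A \<star>\<^bsub>N\<^esub> tensor_power N A k"
  by (induction k) (simp_all add: unit_tensor_left unit_tensor_right einstein_prod_assoc)

lemma tensor_power_2: "A \<in> sq_tensors N \<Longrightarrow> tensor_power N A 2 = A \<star>\<^bsub>N\<^esub> A"
  by (simp add: numeral_2_eq_2 unit_tensor_left)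

lemma conj_transpose_sq: "A \<in> sq_tensors N \<Longrightarrow> conj_transpose A \<in> sq_tensors N"
  by (auto simp: sq_tensors_def conj_transpose_def)

lemma conj_transpose_prod:
  "conj_transpose (A \<star>\<^bsub>N\<^esub> B) = conj_transpose B \<star>\<^bsub>N\<^esub> conj_transpose A"
  by (simp add: conj_transpose_def einstein_prod_def mult.commute)

lemma conj_transpose_conj_transpose [simp]: "conj_transpose (conj_transpose A) = A"
  by (simp add: conj_transpose_def)

section \<open>Powers of a tensor\<close>

lemma exists_linear_relation:
  fixes f :: "'b \<Rightarrow> 'a \<Rightarrow> 'c::field"
  assumes "finite S" "finite I" "card S < card I"
  shows "\<exists>c. (\<exists>t\<in>I. c t \<noteq> 0) \<and> (\<forall>s\<in>S. (\<Sum>t\<in>I. c t * f t s) = 0)"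
  using assms
proof (induction S arbitrary: I f rule: finite_induct)
  case empty
  then have "I \<noteq> {}" by auto
  then show ?case by (intro exI[of _ "\<lambda>_. 1"]) auto
next
  case (insert s S)
  show ?case
  proof (cases "\<forall>t\<in>I. f t s = 0")
    case True
    obtain c where "\<exists>t\<in>I. c t \<noteq> 0" "\<forall>s\<in>S. (\<Sum>t\<in>I. c t * f t s) = 0"
      using insert.IH[of I f] insert.prems insert.hyps by auto
    with True show ?thesis by (intro exI[of _ c]) auto
  next
    case False
    then obtain u where u: "u \<in> I" "f u s \<noteq> 0" by blast
    \<comment> \<open>Eliminate the coordinate \<open>s\<close> with the pivot \<open>u\<close>.\<close>
    define J where "J = I - {u}"
    define g where "g t x = f t x - f t s / f u s * f u x" for t x
    have J: "finite J" "u \<notin> J" "I = insert u J"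
      using u insert.prems by (auto simp: J_def)
    have "card S < card J"
      using insert.prems insert.hyps J by auto
    then obtain c where c: "\<exists>t\<in>J. c t \<noteq> 0" "\<forall>x\<in>S. (\<Sum>t\<in>J. c t * g t x) = 0"
      using insert.IH[OF J(1), of g] by auto
    define b where "b = - (\<Sum>t\<in>J. c t * f t s) / f u s"
    have split: "(\<Sum>t\<in>I. (c(u := b)) t * f t x) = b * f u x + (\<Sum>t\<in>J. c t * f t x)" for x
    proof -
      have "(\<Sum>t\<in>J. (c(u := b)) t * f t x) = (\<Sum>t\<in>J. c t * f t x)"
        using J(2) by (intro sum.cong) auto
      then show ?thesis using J by simp
    qed
    have "b * f u s + (\<Sum>t\<in>J. c t * f t s) = 0"
      using u by (simp add: b_def)
    moreover have "b * f u x + (\<Sum>t\<in>J. c t * f t x) = 0" if "x \<in> S" for x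
    proof -
      have "b * f u x + (\<Sum>t\<in>J. c t * f t x) = (\<Sum>t\<in>J. c t * g t x)"
        by (simp add: b_def g_def sum_divide_distrib sum_distrib_right sum_subtractf
            right_diff_distrib mult.assoc sum_distrib_left)
      with c that show ?thesis by simp
    qed
    moreover have "\<exists>t\<in>I. (c(u := b)) t \<noteq> 0"
      using c(1) J by auto
    ultimately show ?thesis
      using split by (intro exI[of _ "c(u := b)"]) (simp only: ball_simps insert_iff, auto)
  qed
qed

text \<open>
  Finite dimension enters here: the powers of \<open>A\<close> satisfy a linear relation, and dividing it
  by its lowest nonzero coefficient gives the equation below, with \<open>D\<close> a polynomial in \<open>A\<close>.
\<close>

lemma power_strongly_regular:
  assumes A: "A \<in> sq_tensors N"
  obtains k D where "1 \<le> k" "D \<in> sq_tensors N" "A \<star>\<^bsub>N\<^esub> D = D \<star>\<^bsub>N\<^esub> A"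
    "tensor_power N A k = D \<star>\<^bsub>N\<^esub> (A \<star>\<^bsub>N\<^esub> tensor_power N A k)"
proof -
  let ?M = "multi_indices N" and ?P = "tensor_power N A"
  define m where "m = card (?M \<times> ?M)"
  obtain c where c: "\<exists>t\<in>{..m}. c t \<noteq> 0"
    and "\<forall>s\<in>?M \<times> ?M. (\<Sum>t\<in>{..m}. c t * ?P t (fst s) (snd s)) = 0"
    using exists_linear_relation[of "?M \<times> ?M" "{..m}" "\<lambda>t s. ?P t (fst s) (snd s)"]
    by (auto simp: m_def finite_multi_indices)
  then have rel: "(\<Sum>t\<in>{..m}. c t * ?P t i j) = 0" for i j
    using tensor_power_sq[OF A] by (cases "(i, j) \<in> ?M \<times> ?M") (auto simp: sq_tensors_def)
  define k where "k = (LEAST t. t \<le> m \<and> c t \<noteq> 0)"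
  have k: "k \<le> m" "c k \<noteq> 0"
    using c LeastI[of "\<lambda>t. t \<le> m \<and> c t \<noteq> 0"] unfolding k_def by auto
  have below: "c t = 0" if "t < k" for t
    using that not_less_Least[of t "\<lambda>t. t \<le> m \<and> c t \<noteq> 0"] k(1) unfolding k_def by auto
  define D where "D = (\<lambda>i j. \<Sum>t\<in>{k<..m}. - (c t / c k) * ?P (t - Suc k) i j)"
  have D: "D \<in> sq_tensors N"
    using tensor_power_sq[OF A] by (auto simp: D_def sq_tensors_def)
  have DX: "D \<star>\<^bsub>N\<^esub> X = (\<lambda>i j. \<Sum>t\<in>{k<..m}. - (c t / c k) * (?P (t - Suc k) \<star>\<^bsub>N\<^esub> X) i j)" for X
  proof (intro ext)
    fix i j
    have "(D \<star>\<^bsub>N\<^esub> X) i j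
        = (\<Sum>l\<in>?M. \<Sum>t\<in>{k<..m}. - (c t / c k) * ?P (t - Suc k) i l * X l j)"
      by (simp add: einstein_prod_def D_def sum_distrib_right)
    also have "\<dots> = (\<Sum>t\<in>{k<..m}. \<Sum>l\<in>?M. - (c t / c k) * ?P (t - Suc k) i l * X l j)"
      by (rule sum.swap)
    finally show "(D \<star>\<^bsub>N\<^esub> X) i j
        = (\<Sum>t\<in>{k<..m}. - (c t / c k) * (?P (t - Suc k) \<star>\<^bsub>N\<^esub> X) i j)"
      by (simp add: einstein_prod_def sum_distrib_left mult.assoc)
  qed
  have XD: "A \<star>\<^bsub>N\<^esub> D = (\<lambda>i j. \<Sum>t\<in>{k<..m}. - (c t / c k) * (A \<star>\<^bsub>N\<^esub> ?P (t - Suc k)) i j)"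
  proof (intro ext)
    fix i j
    have "(A \<star>\<^bsub>N\<^esub> D) i j
        = (\<Sum>l\<in>?M. \<Sum>t\<in>{k<..m}. - (c t / c k) * (A i l * ?P (t - Suc k) l j))"
      by (simp add: einstein_prod_def D_def sum_distrib_left mult.left_commute)
    also have "\<dots> = (\<Sum>t\<in>{k<..m}. \<Sum>l\<in>?M. - (c t / c k) * (A i l * ?P (t - Suc k) l j))"
      by (rule sum.swap)
    finally show "(A \<star>\<^bsub>N\<^esub> D) i j
        = (\<Sum>t\<in>{k<..m}. - (c t / c k) * (A \<star>\<^bsub>N\<^esub> ?P (t - Suc k)) i j)"
      by (simp add: einstein_prod_def sum_distrib_left)
  qed
  have comm: "A \<star>\<^bsub>N\<^esub> D = D \<star>\<^bsub>N\<^esub> A"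
    by (simp add: DX XD tensor_power_commute[OF A])
  have add: "?P a \<star>\<^bsub>N\<^esub> ?P b = ?P (a + b)" for a b
    by (induction b) (simp_all add: unit_tensor_right tensor_power_sq[OF A]
        flip: einstein_prod_assoc)
  have Dk: "D \<star>\<^bsub>N\<^esub> ?P (Suc k) = ?P k"
  proof (intro ext)
    fix i j
    have "(\<Sum>t\<in>{..m}. c t * ?P t i j) = (\<Sum>t\<in>insert k {k<..m}. c t * ?P t i j)"
      using k by (intro sum.mono_neutral_right) (auto intro: below)
    then have "c k * ?P k i j + (\<Sum>t\<in>{k<..m}. c t * ?P t i j) = 0"
      using rel[of i j] by simp
    then have "?P k i j = - (\<Sum>t\<in>{k<..m}. c t * ?P t i j) / c k"
      using k(2) by (simp add: field_simps eq_neg_iff_add_eq_0)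
    also have "\<dots> = (\<Sum>t\<in>{k<..m}. - (c t / c k) * ?P t i j)"
      by (simp add: sum_divide_distrib sum_negf)
    also have "\<dots> = (D \<star>\<^bsub>N\<^esub> ?P (Suc k)) i j"
      unfolding DX add by (rule sum.cong) auto
    finally show "(D \<star>\<^bsub>N\<^esub> ?P (Suc k)) i j = ?P k i j" by simp
  qed
  \<comment> \<open>The exponent is raised by one because \<open>k\<close> may be 0.\<close>
  have "?P (Suc k) = D \<star>\<^bsub>N\<^esub> (A \<star>\<^bsub>N\<^esub> ?P (Suc k))"
  proof -
    have "D \<star>\<^bsub>N\<^esub> (A \<star>\<^bsub>N\<^esub> ?P (Suc k)) = D \<star>\<^bsub>N\<^esub> ?P (Suc k) \<star>\<^bsub>N\<^esub> A"
      by (metis tensor_power_commute[OF A] einstein_prod_assoc)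
    then show ?thesis by (metis Dk tensor_power.simps(2))
  qed
  with D comm show ?thesis by (intro that[of "Suc k" D]) auto
qed

lemma range_subset_factor:
  assumes A: "A \<in> sq_tensors N" and sub: "tensor_range N A \<subseteq> tensor_range N C"
  obtains W where "W \<in> sq_tensors N" "A = C \<star>\<^bsub>N\<^esub> W"
proof -
  let ?M = "multi_indices N"
  have "\<exists>X\<in>vec_tensors N. einstein_apply N C X = (\<lambda>i. A i j)" if j: "j \<in> ?M" for j
  proof -
    have "(\<lambda>i. A i j) = einstein_apply N A (\<lambda>k. unit_tensor N k j)"
      using fun_cong[OF fun_cong[OF unit_tensor_right[OF A]], of _ j, symmetric]
      unfolding einstein_prod_def einstein_apply_def by (rule ext)
    moreover have "(\<lambda>k. unit_tensor N k j) \<in> vec_tensors N"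
      by (auto simp: vec_tensors_def unit_tensor_def)
    ultimately have "(\<lambda>i. A i j) \<in> tensor_range N A"
      unfolding tensor_range_def by blast
    with sub have "(\<lambda>i. A i j) \<in> tensor_range N C" by blast
    then show ?thesis unfolding tensor_range_def by (elim imageE) (metis)
  qed
  then have "\<forall>j\<in>?M. \<exists>X. X \<in> vec_tensors N \<and> einstein_apply N C X = (\<lambda>i. A i j)"
    by blast
  then obtain X where "\<forall>j\<in>?M. X j \<in> vec_tensors N \<and> einstein_apply N C (X j) = (\<lambda>i. A i j)"
    unfolding bchoice_iff by blast
  then have X: "\<And>j. j \<in> ?M \<Longrightarrow> X j \<in> vec_tensors N"
    "\<And>j. j \<in> ?M \<Longrightarrow> einstein_apply N C (X j) = (\<lambda>i. A i j)"
    by simp_all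
  define W where "W k j = (if j \<in> ?M then X j k else 0)" for k j
  have "W \<in> sq_tensors N"
    using X(1) by (auto simp: sq_tensors_def W_def vec_tensors_def)
  moreover have "A = C \<star>\<^bsub>N\<^esub> W"
  proof (intro ext)
    fix i j
    show "A i j = (C \<star>\<^bsub>N\<^esub> W) i j"
    proof (cases "j \<in> ?M")
      case True
      then show ?thesis
        using fun_cong[OF X(2)[OF True], of i]
        by (simp add: einstein_prod_def W_def einstein_apply_def)
    next
      case False
      then show ?thesis using A by (simp add: einstein_prod_def W_def sq_tensors_def)
    qed
  qed
  ultimately show ?thesis by (rule that)
qed

text \<open>
  Index 1 makes \<open>A\<close> strongly regular; \<open>D \<star> A \<star> D\<close> is then its group inverse.
\<close>

lemma core_tensor_strongly_regular:
  assumes "core_tensor N A"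
  obtains D where "D \<in> sq_tensors N" "A \<star>\<^bsub>N\<^esub> D = D \<star>\<^bsub>N\<^esub> A" "A = D \<star>\<^bsub>N\<^esub> (A \<star>\<^bsub>N\<^esub> A)"
proof -
  let ?P = "tensor_power N A"
  have A: "A \<in> sq_tensors N" and ind: "tensor_index N A = 1"
    using assms by (auto simp: core_tensor_def)
  obtain k D where k: "1 \<le> k" and D: "D \<in> sq_tensors N" "A \<star>\<^bsub>N\<^esub> D = D \<star>\<^bsub>N\<^esub> A"
    and Pk: "?P k = D \<star>\<^bsub>N\<^esub> (A \<star>\<^bsub>N\<^esub> ?P k)"
    using power_strongly_regular[OF A] by blast
  have DP: "D \<star>\<^bsub>N\<^esub> ?P n = ?P n \<star>\<^bsub>N\<^esub> D" for n
    using D by (induction n)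
      (simp_all add: unit_tensor_left unit_tensor_right, metis einstein_prod_assoc)
  \<comment> \<open>Some exponent qualifies in the definition of the index, so the index itself does.\<close>
  have "tensor_range N (?P k) = tensor_range N (?P (k + 1))"
  proof
    have "?P k = ?P (k + 1) \<star>\<^bsub>N\<^esub> D"
      using Pk DP[of "k + 1"] tensor_power_commute[OF A, of k] by simp
    then show "tensor_range N (?P k) \<subseteq> tensor_range N (?P (k + 1))"
      unfolding tensor_range_def
      using einstein_apply_vec[OF D(1)] by (metis einstein_apply_prod image_subsetI imageI)
    show "tensor_range N (?P (k + 1)) \<subseteq> tensor_range N (?P k)"
      unfolding tensor_range_def
      using einstein_apply_vec[OF A] by (auto simp: einstein_apply_prod)
  qed
  then have "tensor_range N (?P 1) = tensor_range N (?P (1 + 1))"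
    using LeastI[of "\<lambda>k. 1 \<le> k \<and> tensor_range N (?P k) = tensor_range N (?P (k + 1))" k] k ind
    by (simp add: tensor_index_def)
  then have "tensor_range N A \<subseteq> tensor_range N (A \<star>\<^bsub>N\<^esub> A)"
    by (simp add: unit_tensor_left[OF A])
  then obtain W where W: "A = A \<star>\<^bsub>N\<^esub> A \<star>\<^bsub>N\<^esub> W"
    using range_subset_factor[OF A] by metis
  have pow: "\<exists>V. A = ?P (Suc n) \<star>\<^bsub>N\<^esub> V" for n
  proof (induction n)
    case 0
    show ?case
      by (intro exI[of _ "unit_tensor N"]) (simp add: unit_tensor_left[OF A] unit_tensor_right[OF A])
  next
    case (Suc n)
    then obtain V where "A = ?P (Suc n) \<star>\<^bsub>N\<^esub> V" by blast
    then have "A = A \<star>\<^bsub>N\<^esub> (?P (Suc n) \<star>\<^bsub>N\<^esub> V) \<star>\<^bsub>N\<^esub> W"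
      using W by simp
    also have "\<dots> = ?P (Suc (Suc n)) \<star>\<^bsub>N\<^esub> (V \<star>\<^bsub>N\<^esub> W)"
      by (metis tensor_power.simps(2) tensor_power_commute[OF A] einstein_prod_assoc)
    finally show ?case by blast
  qed
  \<comment> \<open>The relation for \<open>A\<^sup>k\<close> passes to \<open>A = A\<^sup>k \<star> V\<close>.\<close>
  obtain V where V: "A = ?P k \<star>\<^bsub>N\<^esub> V"
    using pow[of "k - 1"] k by auto
  have "A = D \<star>\<^bsub>N\<^esub> (A \<star>\<^bsub>N\<^esub> A)"
    using V Pk by (metis einstein_prod_assoc)
  with D show ?thesis by (rule that)
qed

section \<open>Existence and uniqueness of the core inverse\<close>

lemma conj_transpose_prod_cancel:
  assumes X: "A \<star>\<^bsub>N\<^esub> X \<in> sq_tensors N" and Y: "A \<star>\<^bsub>N\<^esub> Y \<in> sq_tensors N"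
    and eq: "conj_transpose A \<star>\<^bsub>N\<^esub> (A \<star>\<^bsub>N\<^esub> X) = conj_transpose A \<star>\<^bsub>N\<^esub> (A \<star>\<^bsub>N\<^esub> Y)"
  shows "A \<star>\<^bsub>N\<^esub> X = A \<star>\<^bsub>N\<^esub> Y"
proof -
  let ?M = "multi_indices N"
  define U where "U i j = (A \<star>\<^bsub>N\<^esub> X) i j - (A \<star>\<^bsub>N\<^esub> Y) i j" for i j
  have U_prod: "U = A \<star>\<^bsub>N\<^esub> (\<lambda>i j. X i j - Y i j)"
    by (intro ext) (simp add: U_def einstein_prod_def right_diff_distrib sum_subtractf)
  have "conj_transpose A \<star>\<^bsub>N\<^esub> U = (\<lambda>i j. 0)"
    using eq by (simp add: fun_eq_iff U_def einstein_prod_def right_diff_distrib sum_subtractf)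
  then have "conj_transpose U \<star>\<^bsub>N\<^esub> U = (\<lambda>i j. 0)"
    by (simp add: U_prod conj_transpose_prod einstein_prod_assoc) (simp add: einstein_prod_def)
  then have "(\<Sum>i\<in>?M. cnj (U i j) * U i j) = 0" for j
    by (simp add: fun_eq_iff einstein_prod_def conj_transpose_def)
  then have "complex_of_real (\<Sum>i\<in>?M. (cmod (U i j))\<^sup>2) = 0" for j
    by (simp only: of_real_sum complex_norm_square mult.commute)
  then have "(\<Sum>i\<in>?M. (cmod (U i j))\<^sup>2) = 0" for j
    using of_real_eq_0_iff by blast
  then have "U i j = 0" if "i \<in> ?M" for i j
    using that by (simp add: sum_nonneg_eq_0_iff finite_multi_indices)
  moreover have "U i j = 0" if "i \<notin> ?M" for i j
    using that X Y by (simp add: U_def sq_tensors_def)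
  ultimately show ?thesis
    by (auto simp: fun_eq_iff U_def)
qed

text \<open>
  A \<open>{1,3}\<close>-inverse. With \<open>H = A\<^sup>* \<star> A\<close>, the relation between the powers of \<open>H\<close> can be cancelled
  down to \<open>A = A \<star> D \<star> H\<close>, because \<open>H\<close> is Hermitian.
\<close>

lemma exists_13_inverse:
  assumes A: "A \<in> sq_tensors N"
  obtains S where "S \<in> sq_tensors N" "A \<star>\<^bsub>N\<^esub> S \<star>\<^bsub>N\<^esub> A = A" "conj_transpose (A \<star>\<^bsub>N\<^esub> S) = A \<star>\<^bsub>N\<^esub> S"
proof -
  let ?A' = "conj_transpose A"
  define H where "H = ?A' \<star>\<^bsub>N\<^esub> A"
  let ?P = "tensor_power N H" and ?I = "unit_tensor N"
  have A': "?A' \<in> sq_tensors N" and H: "H \<in> sq_tensors N"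
    using A by (auto simp: H_def intro: conj_transpose_sq einstein_prod_sq)
  have H_herm: "conj_transpose H = H"
    by (simp add: H_def conj_transpose_prod)
  obtain k D where k: "1 \<le> k" and D: "D \<in> sq_tensors N" "H \<star>\<^bsub>N\<^esub> D = D \<star>\<^bsub>N\<^esub> H"
    and Pk: "?P k = D \<star>\<^bsub>N\<^esub> (H \<star>\<^bsub>N\<^esub> ?P k)"
    using power_strongly_regular[OF H] by blast
  have DP: "D \<star>\<^bsub>N\<^esub> ?P n = ?P n \<star>\<^bsub>N\<^esub> D" for n
    using D by (induction n)
      (simp_all add: unit_tensor_left unit_tensor_right, metis einstein_prod_assoc)
  have cancel: "H \<star>\<^bsub>N\<^esub> X = H \<star>\<^bsub>N\<^esub> Y"
    if "?P (Suc n) \<star>\<^bsub>N\<^esub> X = ?P (Suc n) \<star>\<^bsub>N\<^esub> Y" "X \<in> sq_tensors N" "Y \<in> sq_tensors N" for n X Y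
    using that(1)
  proof (induction n)
    case 0
    then show ?case by (simp add: unit_tensor_left[OF H])
  next
    case (Suc n)
    have rw: "?P (Suc (Suc n)) \<star>\<^bsub>N\<^esub> Z = H \<star>\<^bsub>N\<^esub> (H \<star>\<^bsub>N\<^esub> (?P n \<star>\<^bsub>N\<^esub> Z))" for Z
      by (metis tensor_power.simps(2) tensor_power_commute[OF H] einstein_prod_assoc)
    have "H \<star>\<^bsub>N\<^esub> (?P n \<star>\<^bsub>N\<^esub> Z) \<in> sq_tensors N" if "Z \<in> sq_tensors N" for Z
      using that H by (intro einstein_prod_sq tensor_power_sq)
    moreover have "conj_transpose H \<star>\<^bsub>N\<^esub> (H \<star>\<^bsub>N\<^esub> (?P n \<star>\<^bsub>N\<^esub> X))
        = conj_transpose H \<star>\<^bsub>N\<^esub> (H \<star>\<^bsub>N\<^esub> (?P n \<star>\<^bsub>N\<^esub> Y))"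
      using Suc.prems unfolding rw H_herm .
    ultimately have "H \<star>\<^bsub>N\<^esub> (?P n \<star>\<^bsub>N\<^esub> X) = H \<star>\<^bsub>N\<^esub> (?P n \<star>\<^bsub>N\<^esub> Y)"
      using that(2,3) by (metis conj_transpose_prod_cancel)
    then have "?P (Suc n) \<star>\<^bsub>N\<^esub> X = ?P (Suc n) \<star>\<^bsub>N\<^esub> Y"
      by (metis tensor_power.simps(2) tensor_power_commute[OF H] einstein_prod_assoc)
    then show ?case by (rule Suc.IH)
  qed
  have "?P k \<star>\<^bsub>N\<^esub> (D \<star>\<^bsub>N\<^esub> H) = ?P k \<star>\<^bsub>N\<^esub> ?I"
    using Pk DP[of k] tensor_power_commute[OF H, of k]
    by (metis einstein_prod_assoc unit_tensor_right tensor_power_sq[OF H])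
  then have "H \<star>\<^bsub>N\<^esub> (D \<star>\<^bsub>N\<^esub> H) = H \<star>\<^bsub>N\<^esub> ?I"
    using cancel[of "k - 1" "D \<star>\<^bsub>N\<^esub> H" ?I] k einstein_prod_sq[OF D(1) H] unit_tensor_sq
    by (simp del: tensor_power.simps)
  then have "?A' \<star>\<^bsub>N\<^esub> (A \<star>\<^bsub>N\<^esub> (D \<star>\<^bsub>N\<^esub> H)) = ?A' \<star>\<^bsub>N\<^esub> (A \<star>\<^bsub>N\<^esub> ?I)"
    by (simp only: H_def einstein_prod_assoc)
  then have "A \<star>\<^bsub>N\<^esub> (D \<star>\<^bsub>N\<^esub> H) = A \<star>\<^bsub>N\<^esub> ?I"
    by (rule conj_transpose_prod_cancel[rotated 2])
      (intro einstein_prod_sq unit_tensor_sq A D(1) H)+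
  then have ADH: "A \<star>\<^bsub>N\<^esub> (D \<star>\<^bsub>N\<^esub> H) = A"
    by (simp add: unit_tensor_right[OF A])
  define S where "S = conj_transpose D \<star>\<^bsub>N\<^esub> ?A'"
  have S: "S \<in> sq_tensors N"
    using D A by (simp add: S_def einstein_prod_sq conj_transpose_sq)
  have HS: "H \<star>\<^bsub>N\<^esub> S = ?A'"
    using arg_cong[OF ADH, of conj_transpose]
    by (simp add: S_def conj_transpose_prod H_herm einstein_prod_assoc)
  have SH: "conj_transpose S \<star>\<^bsub>N\<^esub> H = A"
    using arg_cong[OF HS, of conj_transpose] by (simp add: conj_transpose_prod H_herm)
  have AS: "A \<star>\<^bsub>N\<^esub> S = conj_transpose (A \<star>\<^bsub>N\<^esub> S)"
    using HS SH conj_transpose_prod[of N A S] by (metis einstein_prod_assoc)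
  have "A \<star>\<^bsub>N\<^esub> S \<star>\<^bsub>N\<^esub> A = A"
    using SH AS unfolding H_def by (metis conj_transpose_prod einstein_prod_assoc)
  with S AS show ?thesis by (metis that)
qed

lemma is_core_inverseD:
  assumes "is_core_inverse N A X" and "A \<in> sq_tensors N"
  shows "X \<in> sq_tensors N" "conj_transpose (A \<star>\<^bsub>N\<^esub> X) = A \<star>\<^bsub>N\<^esub> X"
    "X \<star>\<^bsub>N\<^esub> (A \<star>\<^bsub>N\<^esub> A) = A" "A \<star>\<^bsub>N\<^esub> (X \<star>\<^bsub>N\<^esub> X) = X"
    "A \<star>\<^bsub>N\<^esub> (X \<star>\<^bsub>N\<^esub> A) = A" "X \<star>\<^bsub>N\<^esub> (A \<star>\<^bsub>N\<^esub> X) = X"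
proof -
  show 1: "X \<in> sq_tensors N" "conj_transpose (A \<star>\<^bsub>N\<^esub> X) = A \<star>\<^bsub>N\<^esub> X"
    using assms(1) by (auto simp: is_core_inverse_def)
  show 2: "X \<star>\<^bsub>N\<^esub> (A \<star>\<^bsub>N\<^esub> A) = A" "A \<star>\<^bsub>N\<^esub> (X \<star>\<^bsub>N\<^esub> X) = X"
    using assms 1(1) by (auto simp: is_core_inverse_def tensor_power_2)
  show "A \<star>\<^bsub>N\<^esub> (X \<star>\<^bsub>N\<^esub> A) = A" "X \<star>\<^bsub>N\<^esub> (A \<star>\<^bsub>N\<^esub> X) = X"
    using 2 by (metis einstein_prod_assoc)+
qed

text \<open>
  The equation \<open>Y \<star> C\<^sup>2 = C\<close> is replaced by the weaker \<open>C \<star> Y \<star> C = C\<close>: both \<open>C \<star> E\<close> and \<open>C \<star> Y\<close> are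
  the orthogonal projector onto the range of \<open>C\<close>, and the range of \<open>Y\<close> lies in that of \<open>C\<close>.
\<close>

lemma core_inverse_characterization:
  assumes C: "C \<in> sq_tensors N" and E: "is_core_inverse N C E"
    and CYC: "C \<star>\<^bsub>N\<^esub> (Y \<star>\<^bsub>N\<^esub> C) = C" and herm: "conj_transpose (C \<star>\<^bsub>N\<^esub> Y) = C \<star>\<^bsub>N\<^esub> Y"
    and CYY: "C \<star>\<^bsub>N\<^esub> (Y \<star>\<^bsub>N\<^esub> Y) = Y"
  shows "Y = E"
proof -
  note e = is_core_inverseD[OF E C]
  have le: "(C \<star>\<^bsub>N\<^esub> E) \<star>\<^bsub>N\<^esub> (C \<star>\<^bsub>N\<^esub> Y) = C \<star>\<^bsub>N\<^esub> Y" "(C \<star>\<^bsub>N\<^esub> Y) \<star>\<^bsub>N\<^esub> (C \<star>\<^bsub>N\<^esub> E) = C \<star>\<^bsub>N\<^esub> E"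
    using e(5) CYC by (metis einstein_prod_assoc)+
  have CY: "C \<star>\<^bsub>N\<^esub> Y = C \<star>\<^bsub>N\<^esub> E"
    using arg_cong[OF le(1), of conj_transpose] le(2)
    by (metis conj_transpose_prod e(2) herm)
  have "Y = E \<star>\<^bsub>N\<^esub> (C \<star>\<^bsub>N\<^esub> Y)"
    using CYY e(3) by (metis einstein_prod_assoc)
  also have "\<dots> = E"
    using CY e(6) by simp
  finally show ?thesis .
qed

lemma is_core_inverse_core_inverse:
  assumes core: "core_tensor N A"
  shows "is_core_inverse N A (core_inverse N A)"
proof -
  have A: "A \<in> sq_tensors N"
    using core by (simp add: core_tensor_def)
  obtain D where D: "D \<in> sq_tensors N" "A \<star>\<^bsub>N\<^esub> D = D \<star>\<^bsub>N\<^esub> A" "A = D \<star>\<^bsub>N\<^esub> (A \<star>\<^bsub>N\<^esub> A)"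
    using core_tensor_strongly_regular[OF core] by blast
  obtain S where S: "S \<in> sq_tensors N" "A \<star>\<^bsub>N\<^esub> S \<star>\<^bsub>N\<^esub> A = A"
    "conj_transpose (A \<star>\<^bsub>N\<^esub> S) = A \<star>\<^bsub>N\<^esub> S"
    using exists_13_inverse[OF A] by blast
  \<comment> \<open>The group inverse of \<open>A\<close> composed with the orthogonal projector onto the range of \<open>A\<close>.\<close>
  define X where "X = D \<star>\<^bsub>N\<^esub> (A \<star>\<^bsub>N\<^esub> S)"
  have X: "X \<in> sq_tensors N"
    using A D S by (simp add: X_def einstein_prod_sq)
  have AX: "A \<star>\<^bsub>N\<^esub> X = A \<star>\<^bsub>N\<^esub> S"
    unfolding X_def using D(2,3) by (metis einstein_prod_assoc)
  have XAA: "X \<star>\<^bsub>N\<^esub> (A \<star>\<^bsub>N\<^esub> A) = A"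
    unfolding X_def using D(3) S(2) by (metis einstein_prod_assoc)
  have "A \<star>\<^bsub>N\<^esub> (X \<star>\<^bsub>N\<^esub> X) = (A \<star>\<^bsub>N\<^esub> S) \<star>\<^bsub>N\<^esub> X"
    using AX by (metis einstein_prod_assoc)
  also have "\<dots> = (A \<star>\<^bsub>N\<^esub> S \<star>\<^bsub>N\<^esub> A) \<star>\<^bsub>N\<^esub> (D \<star>\<^bsub>N\<^esub> S)"
    unfolding X_def using D(2) by (metis einstein_prod_assoc)
  also have "\<dots> = X"
    unfolding S(2) X_def using D(2) by (metis einstein_prod_assoc)
  finally have AXX: "A \<star>\<^bsub>N\<^esub> (X \<star>\<^bsub>N\<^esub> X) = X" .
  have "is_core_inverse N A X"
    using A X AX XAA AXX S(3) by (simp add: is_core_inverse_def tensor_power_2)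
  moreover have "Y = X" if "is_core_inverse N A Y" for Y
    using core_inverse_characterization[OF A calculation] is_core_inverseD[OF that A] by blast
  ultimately show ?thesis
    unfolding core_inverse_def by (rule theI)
qed

section \<open>The reverse order law\<close>

lemma commute_range_projector:
  assumes B: "B \<in> sq_tensors N" and X: "is_core_inverse N B X"
    and herm: "conj_transpose P = P" and comm: "B \<star>\<^bsub>N\<^esub> P = P \<star>\<^bsub>N\<^esub> B"
  shows "P \<star>\<^bsub>N\<^esub> (B \<star>\<^bsub>N\<^esub> X) = (B \<star>\<^bsub>N\<^esub> X) \<star>\<^bsub>N\<^esub> P"
proof -
  note x = is_core_inverseD[OF X B]
  let ?Q = "B \<star>\<^bsub>N\<^esub> X"
  \<comment> \<open>\<open>P\<close> leaves the range of \<open>B\<close> invariant, and \<open>P\<close> is Hermitian.\<close>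
  have "P \<star>\<^bsub>N\<^esub> ?Q = ?Q \<star>\<^bsub>N\<^esub> (P \<star>\<^bsub>N\<^esub> ?Q)"
    using x(5) comm by (metis einstein_prod_assoc)
  then show ?thesis
    by (metis conj_transpose_prod herm x(2) einstein_prod_assoc)
qed

lemma commute_core_inverse:
  assumes B: "B \<in> sq_tensors N" and X: "is_core_inverse N B X"
    and herm: "conj_transpose P = P" and comm: "B \<star>\<^bsub>N\<^esub> P = P \<star>\<^bsub>N\<^esub> B"
  shows "P \<star>\<^bsub>N\<^esub> X = X \<star>\<^bsub>N\<^esub> P"
proof -
  note x = is_core_inverseD[OF X B]
  have PX: "P \<star>\<^bsub>N\<^esub> X = B \<star>\<^bsub>N\<^esub> (P \<star>\<^bsub>N\<^esub> (X \<star>\<^bsub>N\<^esub> X))"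
    using x(4) comm by (metis einstein_prod_assoc)
  have "P \<star>\<^bsub>N\<^esub> X = X \<star>\<^bsub>N\<^esub> (B \<star>\<^bsub>N\<^esub> (P \<star>\<^bsub>N\<^esub> X))"
    using PX x(3) by (metis einstein_prod_assoc)
  also have "\<dots> = X \<star>\<^bsub>N\<^esub> (P \<star>\<^bsub>N\<^esub> (B \<star>\<^bsub>N\<^esub> X))"
    using comm by (metis einstein_prod_assoc)
  also have "\<dots> = X \<star>\<^bsub>N\<^esub> (B \<star>\<^bsub>N\<^esub> X) \<star>\<^bsub>N\<^esub> P"
    using commute_range_projector[OF assms] by (simp add: einstein_prod_assoc)
  also have "\<dots> = X \<star>\<^bsub>N\<^esub> P"
    using x(6) by simp
  finally show ?thesis .
qed

theorem theorem3p1: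
  fixes N :: "nat list" and A B :: "nat list \<Rightarrow> nat list \<Rightarrow> complex"
  assumes "1 \<le> length N" and "\<forall>m\<in>set N. 1 \<le> m"
    and "A \<in> sq_tensors N" and "B \<in> sq_tensors N"
    and "core_tensor N A" and "core_tensor N B" and "core_tensor N (A \<star>\<^bsub>N\<^esub> B)"
    and "A \<star>\<^bsub>N\<^esub> B \<star>\<^bsub>N\<^esub> core_inverse N B = B \<star>\<^bsub>N\<^esub> core_inverse N B \<star>\<^bsub>N\<^esub> A"
    and "B \<star>\<^bsub>N\<^esub> A \<star>\<^bsub>N\<^esub> core_inverse N A = A \<star>\<^bsub>N\<^esub> core_inverse N A \<star>\<^bsub>N\<^esub> B"
  shows "core_inverse N (A \<star>\<^bsub>N\<^esub> B) = core_inverse N B \<star>\<^bsub>N\<^esub> core_inverse N A"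
proof -
  define X where "X = core_inverse N A"
  define Z where "Z = core_inverse N B"
  define P where "P = A \<star>\<^bsub>N\<^esub> X"
  define Q where "Q = B \<star>\<^bsub>N\<^esub> Z"
  have X: "is_core_inverse N A X" and Z: "is_core_inverse N B Z"
    using assms(5,6) by (auto simp: X_def Z_def is_core_inverse_core_inverse)
  note x = is_core_inverseD[OF X assms(3)] and z = is_core_inverseD[OF Z assms(4)]
  have AQ: "A \<star>\<^bsub>N\<^esub> Q = Q \<star>\<^bsub>N\<^esub> A" and BP: "B \<star>\<^bsub>N\<^esub> P = P \<star>\<^bsub>N\<^esub> B"
    using assms(8,9) by (simp_all add: P_def Q_def X_def Z_def einstein_prod_assoc)
  have P: "conj_transpose P = P" and Q: "conj_transpose Q = Q"
    using x(2) z(2) by (simp_all add: P_def Q_def)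
  have PQ: "P \<star>\<^bsub>N\<^esub> Q = Q \<star>\<^bsub>N\<^esub> P"
    using commute_range_projector[OF assms(4) Z P BP] by (simp add: Q_def)
  have PZ: "P \<star>\<^bsub>N\<^esub> Z = Z \<star>\<^bsub>N\<^esub> P"
    by (rule commute_core_inverse[OF assms(4) Z P BP])
  have PA: "P \<star>\<^bsub>N\<^esub> A = A" and PX: "P \<star>\<^bsub>N\<^esub> X = X" and QB: "Q \<star>\<^bsub>N\<^esub> B = B" and QZ: "Q \<star>\<^bsub>N\<^esub> Z = Z"
    using x(4,5) z(4,5) by (simp_all add: P_def Q_def einstein_prod_assoc)
  let ?C = "A \<star>\<^bsub>N\<^esub> B" and ?Y = "Z \<star>\<^bsub>N\<^esub> X"
  have CY: "?C \<star>\<^bsub>N\<^esub> ?Y = P \<star>\<^bsub>N\<^esub> Q"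
    using AQ PQ unfolding P_def Q_def by (metis einstein_prod_assoc)
  have "?C \<star>\<^bsub>N\<^esub> (?Y \<star>\<^bsub>N\<^esub> ?C) = P \<star>\<^bsub>N\<^esub> Q \<star>\<^bsub>N\<^esub> ?C"
    by (metis CY einstein_prod_assoc)
  also have "\<dots> = (P \<star>\<^bsub>N\<^esub> A) \<star>\<^bsub>N\<^esub> (Q \<star>\<^bsub>N\<^esub> B)"
    using AQ by (metis einstein_prod_assoc)
  finally have CYC: "?C \<star>\<^bsub>N\<^esub> (?Y \<star>\<^bsub>N\<^esub> ?C) = ?C"
    by (simp add: PA QB)
  have "?C \<star>\<^bsub>N\<^esub> (?Y \<star>\<^bsub>N\<^esub> ?Y) = P \<star>\<^bsub>N\<^esub> (Q \<star>\<^bsub>N\<^esub> Z) \<star>\<^bsub>N\<^esub> X"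
    by (metis CY einstein_prod_assoc)
  also have "\<dots> = Z \<star>\<^bsub>N\<^esub> (P \<star>\<^bsub>N\<^esub> X)"
    by (simp add: QZ PZ einstein_prod_assoc)
  finally have CYY: "?C \<star>\<^bsub>N\<^esub> (?Y \<star>\<^bsub>N\<^esub> ?Y) = ?Y"
    by (simp add: PX)
  have "conj_transpose (?C \<star>\<^bsub>N\<^esub> ?Y) = ?C \<star>\<^bsub>N\<^esub> ?Y"
    unfolding CY using P Q PQ by (metis conj_transpose_prod)
  with core_inverse_characterization[OF einstein_prod_sq[OF assms(3,4)]
      is_core_inverse_core_inverse[OF assms(7)] CYC _ CYY]
  show ?thesis
    by (simp add: X_def Z_def)
qed

end
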